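(* Let $p\in\mathbb{R}^\flat$. There exists a family $(P_\alpha:\alpha\in\mathfrak{c})$ of prime $z$-ideals in $C_0(\mathbb{R})$ with the following properties: (1) if $f\in P_{\alpha_0}$ for some $\alpha_0\in\mathfrak{c}$, then $f\in P_\alpha$ for all but finitely many $\alpha\in\mathfrak{c}$; (2) $\bigcap_{\alpha\ne\alpha_0}P_\alpha\not\subset P_{\alpha_0}$ for each $\alpha_0\in\mathfrak{c}$; (3) each $P_\alpha$ is supported at $p$.
   Context: $\mathfrak{c}=2^{\aleph_0}$, identified with the smallest ordinal of that cardinality. $\mathbb{R}^\flat$ is the one-point compactification of $\mathbb{R}$. $C_0(\mathbb{R})$ is the algebra of continuous scalar-valued functions on $\mathbb{R}$ vanishing at infinity (scalar field real or complex, fixed). $\mathbf{Z}(f)=f^{-1}(0)$. An ideal $I$ of $C_0(\mathbb{R})$ is a $z$-ideal if $g\in I$ whenever $g\in C_0(\mathbb{R})$, $f\in I$ and $\mathbf{Z}(g)\supset\mathbf{Z}(f)$. Prime ideals are proper. A prime ideal $P$ of $C_0(\mathbb{R})$ is supported at $p\in\mathbb{R}$ if $f(p)=0$ for all $f\in P$, and is supported at the point at infinity if no such $p\in\mathbb{R}$ exists. *)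

theory Defs
  imports "HOL-Analysis.Analysis"
begin

text \<open>
  The scalar field is a type \<open>'k :: real_normed_field\<close>. Since the norm of this class is
  multiplicative and extends the absolute value of the reals, its instances are, up to isometric
  isomorphism, exactly the real and the complex numbers (Ostrowski, Gelfand-Mazur).
\<close>

definition C0 :: "(real \<Rightarrow> 'k::real_normed_field) set" where
  "C0 = {f. continuous_on UNIV f \<and> (f \<longlongrightarrow> 0) at_infinity}"

definition zero_set :: "(real \<Rightarrow> 'k::zero) \<Rightarrow> real set" where
  "zero_set f = f -` {0}"

text \<open>
  The algebra \<open>C0\<close> has no unit, so the ideals of HOL-Algebra, which live in unital rings, do not
  apply, and closure under scalar multiplication does not follow from closure under
  multiplication by elements of \<open>C0\<close>.
\<close>

definition C0_ideal :: "(real \<Rightarrow> 'k::real_normed_field) set \<Rightarrow> bool" where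
  "C0_ideal I \<longleftrightarrow>
     I \<subseteq> C0 \<and>
     (\<lambda>x. 0) \<in> I \<and>
     (\<forall>f\<in>I. \<forall>g\<in>I. (\<lambda>x. f x + g x) \<in> I) \<and>
     (\<forall>c. \<forall>f\<in>I. (\<lambda>x. c * f x) \<in> I) \<and>
     (\<forall>f\<in>I. \<forall>g\<in>C0. (\<lambda>x. g x * f x) \<in> I)"

definition C0_prime_ideal :: "(real \<Rightarrow> 'k::real_normed_field) set \<Rightarrow> bool" where
  "C0_prime_ideal P \<longleftrightarrow>
     C0_ideal P \<and> P \<noteq> C0 \<and>
     (\<forall>f\<in>C0. \<forall>g\<in>C0. (\<lambda>x. f x * g x) \<in> P \<longrightarrow> f \<in> P \<or> g \<in> P)"

definition C0_z_ideal :: "(real \<Rightarrow> 'k::real_normed_field) set \<Rightarrow> bool" where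
  "C0_z_ideal I \<longleftrightarrow>
     C0_ideal I \<and> (\<forall>g\<in>C0. \<forall>f\<in>I. zero_set f \<subseteq> zero_set g \<longrightarrow> g \<in> I)"

text \<open>
  The one-point compactification of the reals is \<open>Alexandroff_compactification euclideanreal\<close>,
  whose points are \<open>Some x\<close> for real \<open>x\<close> and the point at infinity \<open>None\<close>.
\<close>

fun supported_at :: "(real \<Rightarrow> 'k::real_normed_field) set \<Rightarrow> real option \<Rightarrow> bool" where
  "supported_at P (Some p) \<longleftrightarrow> (\<forall>f\<in>P. f p = 0)"
| "supported_at P None \<longleftrightarrow> \<not> (\<exists>p. \<forall>f\<in>P. f p = 0)"

text \<open>
  The cardinal \<open>2\<^sup>\<aleph>\<^sup>0\<close> is a well-order of minimal length on the set of all functions from \<open>nat\<close>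
  to \<open>bool\<close>. The elements of its field play the role of the ordinals below the continuum.
\<close>

definition continuum :: "(nat \<Rightarrow> bool) rel" where
  "continuum = BNF_Cardinal_Arithmetic.cexp BNF_Cardinal_Arithmetic.ctwo natLeq"

end

theory Submission
  imports Defs
begin

text \<open>
  Prime \<open>z\<close>-ideals come from prime filters of closed subsets of the line. Take an almost disjoint
  family of continuum many infinite sets of natural numbers (the branches of the binary tree), and
  for each branch the closed set \<open>K {a}\<close> of those points of a Cantor set whose digits vanish along
  the branch \<open>a\<close>. These sets are in general position: any finite intersection \<open>K A\<close> meets every
  neighbourhood \<open>N\<close> of the support point, and a further \<open>K {i}\<close> is nowhere dense in it. Let \<open>G\<close> be a
  minimal prime filter among those containing every \<open>K A\<close> and every neighbourhood of the support
  point; each member of \<open>G\<close> contains some \<open>K A \<inter> N\<close> up to a closed set outside \<open>G\<close>. By density,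
  for each \<open>i\<close> there is a prime filter inside \<open>G\<close> that omits \<open>K {i}\<close> but contains \<open>K A\<close> for all finite
  \<open>A\<close> with \<open>i\<close> not in \<open>A\<close>. A set \<open>Z\<close> in one of these filters is in \<open>G\<close>, so it contains some
  \<open>K A \<inter> N\<close> up to a set outside \<open>G\<close>, and hence lies in the filter of every \<open>i\<close> outside \<open>A\<close>.
\<close>

section \<open>Ideals and prime filters of closed sets\<close>

text \<open>The lattice of all closed sets counts as an ideal; properness will come from avoiding a
  nonempty family \<open>H\<close>.\<close>

definition closed_set_ideal :: "'a::topological_space set set \<Rightarrow> bool" where
  "closed_set_ideal J \<longleftrightarrow>
     {} \<in> J \<and> (\<forall>Z\<in>J. closed Z) \<and>
     (\<forall>Z\<in>J. \<forall>Y. closed Y \<longrightarrow> Y \<subseteq> Z \<longrightarrow> Y \<in> J) \<and>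
     (\<forall>Y\<in>J. \<forall>Z\<in>J. Y \<union> Z \<in> J)"

text \<open>On the real line the closed sets are exactly the zero sets of functions in
  \<open>C0\<close>, which is how these filters give prime z-ideals.\<close>

definition prime_closed_set_filter :: "'a::topological_space set set \<Rightarrow> bool" where
  "prime_closed_set_filter F \<longleftrightarrow>
     UNIV \<in> F \<and> {} \<notin> F \<and> (\<forall>Z\<in>F. closed Z) \<and>
     (\<forall>Y\<in>F. \<forall>Z. closed Z \<longrightarrow> Y \<subseteq> Z \<longrightarrow> Z \<in> F) \<and>
     (\<forall>Y\<in>F. \<forall>Z\<in>F. Y \<inter> Z \<in> F) \<and>
     (\<forall>Y Z. closed Y \<longrightarrow> closed Z \<longrightarrow> Y \<union> Z \<in> F \<longrightarrow> Y \<in> F \<or> Z \<in> F)"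

lemma closed_set_idealI:
  assumes "{} \<in> J"
    and "\<And>Z. Z \<in> J \<Longrightarrow> closed Z"
    and "\<And>Y Z. Z \<in> J \<Longrightarrow> closed Y \<Longrightarrow> Y \<subseteq> Z \<Longrightarrow> Y \<in> J"
    and "\<And>Y Z. Y \<in> J \<Longrightarrow> Z \<in> J \<Longrightarrow> Y \<union> Z \<in> J"
  shows "closed_set_ideal J"
  unfolding closed_set_ideal_def by (intro conjI ballI allI impI) (rule assms; assumption)+

lemma closed_set_idealD:
  assumes "closed_set_ideal J"
  shows "{} \<in> J"
    and "Z \<in> J \<Longrightarrow> closed Z"
    and "Z \<in> J \<Longrightarrow> closed Y \<Longrightarrow> Y \<subseteq> Z \<Longrightarrow> Y \<in> J"
    and "Y \<in> J \<Longrightarrow> Z \<in> J \<Longrightarrow> Y \<union> Z \<in> J"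
  using assms unfolding closed_set_ideal_def by meson+

lemma prime_closed_set_filterD:
  assumes "prime_closed_set_filter F"
  shows "UNIV \<in> F" and "{} \<notin> F"
    and "Z \<in> F \<Longrightarrow> closed Z"
    and "Y \<in> F \<Longrightarrow> closed Z \<Longrightarrow> Y \<subseteq> Z \<Longrightarrow> Z \<in> F"
    and "Y \<in> F \<Longrightarrow> Z \<in> F \<Longrightarrow> Y \<inter> Z \<in> F"
    and "closed Y \<Longrightarrow> closed Z \<Longrightarrow> Y \<union> Z \<in> F \<Longrightarrow> Y \<in> F \<or> Z \<in> F"
  using assms unfolding prime_closed_set_filter_def by meson+

text \<open>For closed \<open>S\<close> this is the ideal generated by \<open>J\<close> and
  \<open>S\<close>. It serves to exploit maximality and, later, to force \<open>K {i}\<close> into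
  an ideal.\<close>

lemma closed_set_ideal_adjoin:
  assumes J: "closed_set_ideal J"
  shows "closed_set_ideal {Y. closed Y \<and> (\<exists>j\<in>J. Y \<subseteq> S \<union> j)}"
proof (rule closed_set_idealI)
  show "{} \<in> {Y. closed Y \<and> (\<exists>j\<in>J. Y \<subseteq> S \<union> j)}"
    using closed_set_idealD(1)[OF J] by auto
next
  fix Y Z assume "Y \<in> {Y. closed Y \<and> (\<exists>j\<in>J. Y \<subseteq> S \<union> j)}" "Z \<in> {Y. closed Y \<and> (\<exists>j\<in>J. Y \<subseteq> S \<union> j)}"
  then obtain j k where "closed Y" "closed Z" "j \<in> J" "Y \<subseteq> S \<union> j" "k \<in> J" "Z \<subseteq> S \<union> k"
    by auto
  moreover from this have "j \<union> k \<in> J" "Y \<union> Z \<subseteq> S \<union> (j \<union> k)"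
    using closed_set_idealD(4)[OF J] by auto
  ultimately show "Y \<union> Z \<in> {Y. closed Y \<and> (\<exists>j\<in>J. Y \<subseteq> S \<union> j)}"
    by blast
qed (auto dest: subset_trans)

lemma closed_set_ideal_Union_chain:
  assumes "\<C> \<noteq> {}" and chain: "subset.chain {J. closed_set_ideal J} \<C>"
  shows "closed_set_ideal (\<Union>\<C>)"
proof -
  have ideal: "closed_set_ideal J" if "J \<in> \<C>" for J
    using chain that by (auto simp: subset_chain_def)
  have "Y \<union> Z \<in> \<Union>\<C>" if YZ: "Y \<in> J" "J \<in> \<C>" "Z \<in> J'" "J' \<in> \<C>" for Y Z J J'
  proof -
    have "J \<subseteq> J' \<or> J' \<subseteq> J"
      using chain YZ by (auto simp: subset_chain_def)
    then obtain J'' where "J'' \<in> \<C>" "Y \<in> J''" "Z \<in> J''"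
      using YZ by blast
    then show ?thesis
      using closed_set_idealD(4)[OF ideal] by blast
  qed
  moreover obtain J where "J \<in> \<C>"
    using assms(1) by blast
  moreover note idealD = closed_set_idealD(1-3)[OF ideal]
  ultimately show ?thesis
    by (intro closed_set_idealI) (blast intro: idealD(1), meson UnionE idealD(2), meson UnionE UnionI idealD(3), blast)
qed

text \<open>Zorn's lemma. Maximality is recorded in usable form: adjoining a closed \<open>Z\<close>
  outside \<open>J\<close> captures a member of \<open>H\<close>.\<close>

lemma maximal_closed_set_ideal:
  assumes I: "closed_set_ideal I" and disj: "I \<inter> H = {}"
  obtains J where "closed_set_ideal J" "I \<subseteq> J" "J \<inter> H = {}"
    "\<And>Z. closed Z \<Longrightarrow> Z \<notin> J \<Longrightarrow> \<exists>h\<in>H. \<exists>j\<in>J. h \<subseteq> Z \<union> j"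
proof -
  define \<A> where "\<A> = {J. closed_set_ideal J \<and> I \<subseteq> J \<and> J \<inter> H = {}}"
  have "\<exists>J\<in>\<A>. \<forall>J'\<in>\<A>. J \<subseteq> J' \<longrightarrow> J' = J"
  proof (rule subset_Zorn_nonempty)
    show "\<A> \<noteq> {}"
      using assms by (auto simp: \<A>_def)
  next
    fix \<C> assume C: "\<C> \<noteq> {}" "subset.chain \<A> \<C>"
    then have "closed_set_ideal (\<Union>\<C>)"
      by (intro closed_set_ideal_Union_chain) (auto simp: subset_chain_def \<A>_def)
    moreover have "I \<subseteq> J \<and> J \<inter> H = {}" if "J \<in> \<C>" for J
      using C(2) that by (auto simp: subset_chain_def \<A>_def)
    ultimately show "\<Union>\<C> \<in> \<A>"
      using C(1) unfolding \<A>_def by blast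
  qed
  then obtain J where "J \<in> \<A>" and max: "\<And>J'. J' \<in> \<A> \<Longrightarrow> J \<subseteq> J' \<Longrightarrow> J' = J"
    by meson
  then have J: "closed_set_ideal J" "I \<subseteq> J" "J \<inter> H = {}"
    by (simp_all add: \<A>_def)
  note JD = closed_set_idealD[OF J(1)]
  have "\<exists>h\<in>H. \<exists>j\<in>J. h \<subseteq> Z \<union> j" if Z: "closed Z" "Z \<notin> J" for Z
  proof -
    \<comment> \<open>If the ideal generated by \<open>J\<close> and \<open>Z\<close> still avoided
      \<open>H\<close>, it would equal \<open>J\<close> by maximality, yet it contains
      \<open>Z\<close>.\<close>
    define J' where "J' = {Y. closed Y \<and> (\<exists>j\<in>J. Y \<subseteq> Z \<union> j)}"
    have "closed_set_ideal J'"
      unfolding J'_def by (rule closed_set_ideal_adjoin[OF J(1)])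
    moreover have "J \<subseteq> J'"
      using JD(2) by (auto simp: J'_def)
    moreover have "Z \<in> J'"
      using Z JD(1) by (auto simp: J'_def)
    ultimately have "J' \<inter> H \<noteq> {}"
      using max[of J'] Z(2) J(2) by (auto simp: \<A>_def)
    then show ?thesis
      unfolding J'_def by blast
  qed
  then show thesis
    by (rule that[OF J])
qed

text \<open>The prime ideal theorem for the distributive lattice of closed sets. Upward closure and
  primeness of the complement restate ideal properties of \<open>J\<close>; closure under
  intersections is where maximality and directedness enter.\<close>

lemma prime_closed_set_filter_Compl:
  assumes J: "closed_set_ideal J" and disj: "J \<inter> H = {}" and "H \<noteq> {}"
    and closed: "\<And>h. h \<in> H \<Longrightarrow> closed h"
    and directed: "\<And>h h'. h \<in> H \<Longrightarrow> h' \<in> H \<Longrightarrow> \<exists>k\<in>H. k \<subseteq> h \<inter> h'"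
    and max: "\<And>Z. closed Z \<Longrightarrow> Z \<notin> J \<Longrightarrow> \<exists>h\<in>H. \<exists>j\<in>J. h \<subseteq> Z \<union> j"
  shows "prime_closed_set_filter (Collect closed - J)"
proof -
  note JD = closed_set_idealD[OF J]
  have inter: "Y \<inter> Z \<notin> J" if Y: "closed Y" "Y \<notin> J" and Z: "closed Z" "Z \<notin> J" for Y Z
  proof
    assume "Y \<inter> Z \<in> J"
    obtain h j h' j' where hj: "h \<in> H" "j \<in> J" "h \<subseteq> Y \<union> j" "h' \<in> H" "j' \<in> J" "h' \<subseteq> Z \<union> j'"
      using max[OF Y] max[OF Z] by blast
    obtain k where k: "k \<in> H" "k \<subseteq> h \<inter> h'"
      using directed[OF hj(1,4)] by blast
    \<comment> \<open>By distributivity this set contains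
      \<open>(Y \<union> j) \<inter> (Z \<union> j')\<close>, hence \<open>k\<close>.\<close>
    have "(Y \<inter> Z) \<union> (j \<union> j') \<in> J"
      using JD(4)[OF \<open>Y \<inter> Z \<in> J\<close> JD(4)[OF hj(2,5)]] .
    moreover have "k \<subseteq> (Y \<inter> Z) \<union> (j \<union> j')"
      using k(2) hj(3,6) by auto
    ultimately have "k \<in> J"
      using JD(3) closed[OF k(1)] by meson
    with k disj show False by blast
  qed
  have "UNIV \<notin> J"
  proof
    assume "UNIV \<in> J"
    then have "H \<subseteq> J"
      using JD(3)[OF _ closed subset_UNIV] by blast
    with \<open>H \<noteq> {}\<close> disj show False by blast
  qed
  show ?thesis
    unfolding prime_closed_set_filter_def
  proof (intro conjI ballI allI impI)
    show "UNIV \<in> Collect closed - J" "{} \<notin> Collect closed - J"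
      using \<open>UNIV \<notin> J\<close> JD(1) by auto
    show "closed Z" if "Z \<in> Collect closed - J" for Z
      using that by simp
    show "Z \<in> Collect closed - J" if "Y \<in> Collect closed - J" "closed Z" "Y \<subseteq> Z" for Y Z
      using that JD(3)[of Z Y] by auto
    show "Y \<inter> Z \<in> Collect closed - J" if "Y \<in> Collect closed - J" "Z \<in> Collect closed - J" for Y Z
      using that inter[of Y Z] by auto
    show "Y \<in> Collect closed - J \<or> Z \<in> Collect closed - J"
      if "closed Y" "closed Z" "Y \<union> Z \<in> Collect closed - J" for Y Z
      using that JD(4)[of Y Z] by blast
  qed
qed

text \<open>
  The set \<open>K A\<close> plays the role of the intersection of the \<open>K {a}\<close> for \<open>a\<close> in \<open>A\<close>. The filter \<open>G\<close>
  of the introduction is the complement of the ideal \<open>J\<close> in the proof.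
\<close>

lemma pseudofinite_prime_filters:
  fixes K :: "'i set \<Rightarrow> 'a::topological_space set"
  assumes K_closed: "\<And>A. finite A \<Longrightarrow> closed (K A)"
    and K_antimono: "\<And>A B. A \<subseteq> B \<Longrightarrow> K B \<subseteq> K A"
    and K_dense: "\<And>A i. finite A \<Longrightarrow> i \<notin> A \<Longrightarrow> K A \<subseteq> closure (K A - K {i})"
    and K_meets: "\<And>A N. finite A \<Longrightarrow> N \<in> \<N> \<Longrightarrow> K A \<inter> N \<noteq> {}"
    and N_closed: "\<And>N. N \<in> \<N> \<Longrightarrow> closed N"
    and N_nonempty: "\<N> \<noteq> {}"
    and N_directed: "\<And>N N'. N \<in> \<N> \<Longrightarrow> N' \<in> \<N> \<Longrightarrow> \<exists>M\<in>\<N>. M \<subseteq> N \<inter> N'"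
    and N_interior: "\<And>N. N \<in> \<N> \<Longrightarrow> \<exists>M\<in>\<N>. M \<subseteq> interior N"
  obtains F where "\<And>i. prime_closed_set_filter (F i)" "\<And>i. \<N> \<subseteq> F i"
    "\<And>i Z. Z \<in> F i \<Longrightarrow> finite {j. Z \<notin> F j}"
    "\<And>i. K {i} \<notin> F i" "\<And>i j. i \<noteq> j \<Longrightarrow> K {j} \<in> F i"
proof -
  \<comment> \<open>A filter base built from the neighbourhoods and the \<open>K A\<close> with no
    index of \<open>A\<close> in \<open>X\<close>. The base \<open>H {}\<close> generates the
    conditions on \<open>G\<close>, and \<open>H {i}\<close> those on the filter that is to omit
    \<open>K {i}\<close>.\<close>
  define H where "H X = {K A \<inter> N | A N. finite A \<and> A \<inter> X = {} \<and> N \<in> \<N>}" for X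
  have HI: "K A \<inter> N \<in> H X" if "finite A" "A \<inter> X = {}" "N \<in> \<N>" for A N X
    using that unfolding H_def by blast
  have H_closed: "closed h" if "h \<in> H X" for h X
    using that K_closed N_closed unfolding H_def by blast
  have H_directed: "\<exists>k\<in>H X. k \<subseteq> h \<inter> h'" if hh: "h \<in> H X" "h' \<in> H X" for h h' X
  proof -
    obtain A N A' N' where AN: "finite A" "A \<inter> X = {}" "N \<in> \<N>" "h = K A \<inter> N"
      "finite A'" "A' \<inter> X = {}" "N' \<in> \<N>" "h' = K A' \<inter> N'"
      using hh unfolding H_def by blast
    obtain M where M: "M \<in> \<N>" "M \<subseteq> N \<inter> N'"
      using N_directed AN by blast
    have "K (A \<union> A') \<inter> M \<in> H X"
      using AN M by (intro HI) auto
    moreover have "K (A \<union> A') \<inter> M \<subseteq> h \<inter> h'"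
      using K_antimono[of A "A \<union> A'"] K_antimono[of A' "A \<union> A'"] AN M by blast
    ultimately show ?thesis by blast
  qed
  have H_nonempty: "H X \<noteq> {}" for X
    using N_nonempty HI[of "{}" X] by blast
  have "closed_set_ideal {{} :: 'a set}"
    by (auto simp: closed_set_ideal_def)
  moreover have "{{}} \<inter> H {} = {}"
    using K_meets unfolding H_def by blast
  ultimately obtain J where J: "closed_set_ideal J" "J \<inter> H {} = {}"
    and J_max: "\<And>Z. closed Z \<Longrightarrow> Z \<notin> J \<Longrightarrow> \<exists>h\<in>H {}. \<exists>j\<in>J. h \<subseteq> Z \<union> j"
    by (rule maximal_closed_set_ideal) blast
  note JD = closed_set_idealD[OF J(1)]
  \<comment> \<open>This is where density is used: if \<open>K {i}\<close> and \<open>W\<close>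
    covered \<open>K A \<inter> N\<close>, the closed set \<open>W\<close> would contain the part of
    \<open>K A - K {i}\<close> in the interior of \<open>N\<close>, hence its closure, hence
    \<open>K A \<inter> M\<close>. But no member of \<open>H {}\<close> lies in
    \<open>J\<close>.\<close>
  have not_below: "\<not> K A \<inter> N \<subseteq> K {i} \<union> W"
    if A: "finite A" "i \<notin> A" and N: "N \<in> \<N>" and W: "W \<in> J" for A N W i
  proof
    assume sub: "K A \<inter> N \<subseteq> K {i} \<union> W"
    obtain M where M: "M \<in> \<N>" "M \<subseteq> interior N"
      using N_interior N by blast
    have "interior N \<inter> closure (K A - K {i}) \<subseteq> closure (interior N \<inter> (K A - K {i}))"
      by (intro open_Int_closure_subset open_interior)
    also have "\<dots> \<subseteq> W"
      using sub interior_subset[of N] JD(2)[OF W] by (intro closure_minimal) blast+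
    finally have "K A \<inter> M \<subseteq> W"
      using K_dense[OF A] M by blast
    then have "K A \<inter> M \<in> J"
      using JD(3)[OF W] K_closed[OF A(1)] N_closed[OF M(1)] by blast
    with HI[OF A(1) _ M(1), of "{}"] J(2) show False by blast
  qed
  \<comment> \<open>Containing \<open>J\<close> puts the complement of \<open>Q\<close> inside
    \<open>G\<close>, containing \<open>K {i}\<close> keeps that set out of the filter, and avoiding
    \<open>H {i}\<close> keeps all other \<open>K {j}\<close> in it.\<close>
  have "\<exists>Q. closed_set_ideal Q \<and> {Y. closed Y \<and> (\<exists>W\<in>J. Y \<subseteq> K {i} \<union> W)} \<subseteq> Q \<and> Q \<inter> H {i} = {}
      \<and> (\<forall>Z. closed Z \<longrightarrow> Z \<notin> Q \<longrightarrow> (\<exists>h\<in>H {i}. \<exists>j\<in>Q. h \<subseteq> Z \<union> j))" for i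
  proof -
    let ?I = "{Y. closed Y \<and> (\<exists>W\<in>J. Y \<subseteq> K {i} \<union> W)}"
    have "closed_set_ideal ?I"
      by (rule closed_set_ideal_adjoin[OF J(1)])
    moreover have "?I \<inter> H {i} = {}"
      using not_below unfolding H_def by blast
    ultimately show ?thesis
      by (rule maximal_closed_set_ideal) blast
  qed
  then obtain Q where Q_spec: "\<forall>i. closed_set_ideal (Q i)
      \<and> {Y. closed Y \<and> (\<exists>W\<in>J. Y \<subseteq> K {i} \<union> W)} \<subseteq> Q i \<and> Q i \<inter> H {i} = {}
      \<and> (\<forall>Z. closed Z \<longrightarrow> Z \<notin> Q i \<longrightarrow> (\<exists>h\<in>H {i}. \<exists>j\<in>Q i. h \<subseteq> Z \<union> j))"
    by (rule choice[OF allI, THEN exE])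
  have Q: "closed_set_ideal (Q i)" "Q i \<inter> H {i} = {}"
    and Q_sub: "{Y. closed Y \<and> (\<exists>W\<in>J. Y \<subseteq> K {i} \<union> W)} \<subseteq> Q i" for i
    using Q_spec[THEN spec, of i] by meson+
  have Q_max: "\<exists>h\<in>H {i}. \<exists>j\<in>Q i. h \<subseteq> Z \<union> j" if "closed Z" "Z \<notin> Q i" for i Z
    using Q_spec[THEN spec, of i] that by meson
  note QD = closed_set_idealD[OF Q(1)]
  have J_sub: "J \<subseteq> Q i" for i
    using Q_sub[of i] JD(2) by blast
  define F where "F i = Collect closed - Q i" for i
  have FI: "Z \<in> F i" if "h \<in> H {i}" "closed Z" "h \<subseteq> Z" for h Z i
    using that Q(2)[of i] QD(3)[of Z i h] H_closed[of h "{i}"] unfolding F_def by blast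
  show thesis
  proof
    show "prime_closed_set_filter (F i)" for i
      unfolding F_def
      by (rule prime_closed_set_filter_Compl[OF Q H_nonempty H_closed H_directed Q_max])
    show "\<N> \<subseteq> F i" for i
      using FI[OF HI[of "{}" "{i}"] N_closed] by auto
    show "K {i} \<notin> F i" for i
      using Q_sub[of i] K_closed[of "{i}"] JD(1) unfolding F_def by blast
    show "K {j} \<in> F i" if "i \<noteq> j" for i j
    proof -
      obtain N where "N \<in> \<N>"
        using N_nonempty by auto
      then show ?thesis
        using FI[OF HI[of "{j}" "{i}" N] K_closed[of "{j}"]] that by auto
    qed
    show "finite {j. Z \<notin> F j}" if "Z \<in> F i" for i Z
    proof -
      have Z: "closed Z" "Z \<notin> J"
        using that J_sub[of i] by (auto simp: F_def)
      then obtain h k where hk: "h \<in> H {}" "k \<in> J" "h \<subseteq> Z \<union> k"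
        using J_max by meson
      then obtain A N where A: "finite A" "N \<in> \<N>" "h = K A \<inter> N"
        unfolding H_def by blast
      \<comment> \<open>The covering \<open>h \<subseteq> Z \<union> k\<close> was found from
        \<open>J\<close> alone, so it is the same for all \<open>j\<close>. If \<open>Z\<close> were
        in \<open>Q j\<close>, so would be \<open>h\<close>, although \<open>j\<close> outside
        \<open>A\<close> makes \<open>h\<close> a member of \<open>H {j}\<close>.\<close>
      have "Z \<in> F j" if "j \<notin> A" for j
      proof (rule ccontr)
        assume "Z \<notin> F j"
        then have "Z \<in> Q j" "k \<in> Q j"
          using Z(1) hk(2) J_sub by (auto simp: F_def)
        then have "h \<in> Q j"
          using QD(3)[OF QD(4) H_closed[OF hk(1)] hk(3)] by simp
        moreover have "h \<in> H {j}"
          unfolding A(3) using that by (intro HI A) simp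
        ultimately show False
          using Q(2)[of j] by auto
      qed
      then show ?thesis
        by (intro finite_subset[OF _ A(1)]) blast
    qed
  qed
qed

section \<open>Closed sets in general position\<close>

text \<open>Digits 0 and 1 in base 3 parametrize the middle-thirds Cantor set scaled by one
  half.\<close>

definition cantor_sum :: "(nat \<Rightarrow> bool) \<Rightarrow> real" where
  "cantor_sum x = (\<Sum>n. of_bool (x n) * (1/3) ^ Suc n)"

lemma summable_cantor_sum: "summable (\<lambda>n. of_bool (x n) * (1/3 :: real) ^ Suc n)"
  by (rule summable_comparison_test'[where g = "\<lambda>n. (1/3) ^ Suc n" and N = 0])
     (auto simp: summable_geometric)

lemma cantor_sum_bounds: "0 \<le> cantor_sum x" "cantor_sum x \<le> 1/2"
proof -
  show "0 \<le> cantor_sum x"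
    unfolding cantor_sum_def by (intro suminf_nonneg summable_cantor_sum) auto
  have "(\<lambda>n. (1/3 :: real) ^ Suc n) sums (1/2)"
    using sums_mult[OF geometric_sums[of "1/3 :: real"], of "1/3"] by simp
  then show "cantor_sum x \<le> 1/2"
    unfolding cantor_sum_def by (intro sums_le[OF _ summable_sums[OF summable_cantor_sum]]) auto
qed

lemma cantor_sum_rec: "cantor_sum x = (of_bool (x 0) + cantor_sum (\<lambda>n. x (Suc n))) / 3"
proof -
  have "cantor_sum x = (\<Sum>n. of_bool (x (Suc n)) * (1/3) ^ Suc (Suc n)) + of_bool (x 0) / 3"
    unfolding cantor_sum_def using suminf_split_head[OF summable_cantor_sum[of x]] by simp
  also have "(\<Sum>n. of_bool (x (Suc n)) * (1/3 :: real) ^ Suc (Suc n)) = cantor_sum (\<lambda>n. x (Suc n)) / 3"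
    unfolding cantor_sum_def using suminf_mult[OF summable_cantor_sum[of "\<lambda>n. x (Suc n)"], of "1/3"]
    by (simp add: mult_ac)
  finally show ?thesis by simp
qed

text \<open>A leading digit 0 puts the sum in [0, 1/6] and a leading digit 1 puts it in [1/3, 1/2],
  so the first digit can be read off. Shifting gives the others by induction.\<close>

lemma inj_cantor_sum: "inj cantor_sum"
proof (rule injI, rule ext)
  fix x y n assume "cantor_sum x = cantor_sum y"
  then show "x n = y n"
  proof (induction n arbitrary: x y)
    case 0
    then show ?case
      using cantor_sum_rec[of x] cantor_sum_rec[of y]
        cantor_sum_bounds[of "\<lambda>n. x (Suc n)"] cantor_sum_bounds[of "\<lambda>n. y (Suc n)"]
      by (auto simp: of_bool_def split: if_splits)
  next
    case (Suc n)
    have "x 0 = y 0"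
      using Suc.prems cantor_sum_rec[of x] cantor_sum_rec[of y]
        cantor_sum_bounds[of "\<lambda>n. x (Suc n)"] cantor_sum_bounds[of "\<lambda>n. y (Suc n)"]
      by (auto simp: of_bool_def split: if_splits)
    then show ?case
      using Suc.IH[of "\<lambda>n. x (Suc n)" "\<lambda>n. y (Suc n)"] Suc.prems
        cantor_sum_rec[of x] cantor_sum_rec[of y] by simp
  qed
qed

lemma cantor_sum_upd:
  assumes "\<not> x n"
  shows "cantor_sum (x(n := True)) = cantor_sum x + (1/3) ^ Suc n"
  using assms
proof (induction n arbitrary: x)
  case 0
  have "(\<lambda>m. (x(0 := True)) (Suc m)) = (\<lambda>m. x (Suc m))"
    by auto
  with 0 show ?case
    using cantor_sum_rec[of x] cantor_sum_rec[of "x(0 := True)"] by (simp del: fun_upd_apply add: fun_upd_same)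
next
  case (Suc n)
  have "(\<lambda>m. (x(Suc n := True)) (Suc m)) = (\<lambda>m. x (Suc m))(n := True)"
    by auto
  then show ?case
    using cantor_sum_rec[of x] cantor_sum_rec[of "x(Suc n := True)"]
      Suc.IH[of "\<lambda>m. x (Suc m)"] Suc.prems by (simp del: fun_upd_apply add: fun_upd_other)
qed

text \<open>The partial sums depend on finitely many coordinates of a product of discrete spaces and
  converge uniformly.\<close>

lemma continuous_on_cantor_sum: "continuous_on UNIV cantor_sum"
proof -
  have "uniform_limit UNIV (\<lambda>n x. \<Sum>i<n. of_bool (x i) * (1/3 :: real) ^ Suc i) cantor_sum sequentially"
    unfolding cantor_sum_def
    by (rule Weierstrass_m_test[where M = "\<lambda>n. (1/3) ^ Suc n"]) (auto simp: summable_geometric)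
  moreover have "continuous_on UNIV (\<lambda>x :: nat \<Rightarrow> bool. \<Sum>i<n. of_bool (x i) * (1/3 :: real) ^ Suc i)" for n
  proof -
    have "continuous_on UNIV (of_bool :: bool \<Rightarrow> real)"
      by (simp add: continuous_on_open_vimage open_discrete)
    then have "continuous_on UNIV (\<lambda>x :: nat \<Rightarrow> bool. of_bool (x i) :: real)" for i
      by (rule continuous_on_compose2[where f = "\<lambda>x. x i" and t = UNIV])
         (rule continuous_on_product_coordinates, rule subset_UNIV)
    then show ?thesis
      by (intro continuous_on_sum continuous_on_mult continuous_on_const)
  qed
  ultimately show ?thesis
    by (rule uniform_limit_theorem[OF always_eventually[OF allI] _ sequentially_bot, rotated])
qed

text \<open>By Tychonoff the space of digit sequences is compact, and requiring digits to vanish is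
  a closed condition.\<close>

lemma compact_cantor_sum_image: "compact (cantor_sum ` {x. \<forall>n\<in>M. \<not> x n})"
proof (rule compact_continuous_image)
  show "continuous_on {x. \<forall>n\<in>M. \<not> x n} cantor_sum"
    using continuous_on_cantor_sum continuous_on_subset by blast
  have "compact_space (euclidean :: bool topology)"
    by (simp add: compact_space_def finite_imp_compact)
  then have "compact_space (product_topology (\<lambda>n :: nat. euclidean :: bool topology) UNIV)"
    by (simp add: compact_space_product_topology)
  then have "compact (UNIV :: (nat \<Rightarrow> bool) set)"
    unfolding euclidean_product_topology by (simp add: compact_space_def)
  moreover have "closed {x :: nat \<Rightarrow> bool. \<forall>n\<in>M. \<not> x n}"
  proof -
    have "closed {x :: nat \<Rightarrow> bool. \<not> x n}" for n
      using closed_vimage[of "{False}", OF _ continuous_on_product_coordinates[of n]]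
      by (simp add: vimage_def closed_def open_discrete)
    then show ?thesis
      by (auto simp: Collect_ball_eq)
  qed
  ultimately show "compact {x :: nat \<Rightarrow> bool. \<forall>n\<in>M. \<not> x n}"
    using compact_Int_closed by fastforce
qed

text \<open>
  Integer translates let the set meet every neighbourhood of infinity. They are disjoint because
  \<open>cantor_sum\<close> is at most \<open>1/2\<close>.
\<close>

definition cantor_translates :: "real \<Rightarrow> nat set \<Rightarrow> real set" where
  "cantor_translates q M = {q + of_int k + cantor_sum x | k x. \<forall>n\<in>M. \<not> x n}"

lemma closed_cantor_translates: "closed (cantor_translates q M)"
proof -
  \<comment> \<open>A translate of the sum of the closed set of integers and a compact set.\<close>
  have "cantor_translates q M = (+) q ` (\<Union>k\<in>\<int>. \<Union>y\<in>cantor_sum ` {x. \<forall>n\<in>M. \<not> x n}. {k + y})"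
    unfolding cantor_translates_def Ints_def by (auto simp: add.assoc image_iff)
  then show ?thesis
    using closed_compact_sums[OF closed_Ints compact_cantor_sum_image[of M]]
    by (simp add: closed_translation)
qed

text \<open>Two Cantor sums differ by less than 1, so a point determines its integer
  \<open>k\<close> and then, by injectivity, its digits. Membership can thus be tested on any one
  representation.\<close>

lemma cantor_translates_iff:
  "q + of_int k + cantor_sum x \<in> cantor_translates q M \<longleftrightarrow> (\<forall>n\<in>M. \<not> x n)"
proof
  assume "q + of_int k + cantor_sum x \<in> cantor_translates q M"
  then obtain l y where l: "of_int k + cantor_sum x = of_int l + cantor_sum y" and y: "\<forall>n\<in>M. \<not> y n"
    unfolding cantor_translates_def by auto
  have "k = l"
    using l cantor_sum_bounds[of x] cantor_sum_bounds[of y] by linarith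
  with l have "x = y"
    using injD[OF inj_cantor_sum] by simp
  with y show "\<forall>n\<in>M. \<not> x n" by simp
qed (auto simp: cantor_translates_def)

lemma cantor_translates_antimono: "M \<subseteq> M' \<Longrightarrow> cantor_translates q M' \<subseteq> cantor_translates q M"
  unfolding cantor_translates_def by blast

lemma mem_cantor_translates: "q + of_int k \<in> cantor_translates q M"
proof -
  have "cantor_sum (\<lambda>_. False) = 0"
    by (simp add: cantor_sum_def)
  then show ?thesis
    using cantor_translates_iff[of q k "\<lambda>_. False" M] by simp
qed

text \<open>A point of both sets is approximated by switching on one far digit in
  \<open>M' - M\<close>: the new point keeps its zeros on \<open>M\<close>, leaves the smaller set
  and moves by only \<open>(1/3) ^ Suc n\<close>.\<close>

lemma cantor_translates_dense:
  assumes "infinite (M' - M)"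
  shows "cantor_translates q M \<subseteq> closure (cantor_translates q M - cantor_translates q M')"
proof
  fix y assume "y \<in> cantor_translates q M"
  then obtain k x where y: "y = q + of_int k + cantor_sum x" and x: "\<forall>n\<in>M. \<not> x n"
    unfolding cantor_translates_def by auto
  show "y \<in> closure (cantor_translates q M - cantor_translates q M')"
  proof (cases "\<forall>n\<in>M'. \<not> x n")
    case False
    then have "y \<in> cantor_translates q M - cantor_translates q M'"
      using x by (auto simp: y cantor_translates_iff)
    then show ?thesis
      by (rule closure_subset[THEN subsetD])
  next
    case True
    show ?thesis
      unfolding closure_approachable
    proof (intro allI impI)
      fix e :: real assume "e > 0"
      then obtain m where m: "(1/3) ^ m < e"
        using real_arch_pow_inv[of e "1/3"] by auto
      obtain n where n: "n \<in> M' - M" "n \<ge> m"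
        using assms by (meson infinite_nat_iff_unbounded_le)
      let ?z = "q + of_int k + cantor_sum (x(n := True))"
      have "?z \<in> cantor_translates q M - cantor_translates q M'"
        using x n by (auto simp: cantor_translates_iff)
      moreover have "dist ?z y < e"
      proof -
        have "dist ?z y = (1/3) ^ Suc n"
          using cantor_sum_upd[of x n] True n by (simp add: y dist_real_def)
        also have "\<dots> \<le> (1/3) ^ m"
          using n by (intro power_decreasing) auto
        finally show ?thesis using m by simp
      qed
      ultimately show "\<exists>z\<in>cantor_translates q M - cantor_translates q M'. dist z y < e" by blast
    qed
  qed
qed

section \<open>Almost disjoint branches of the binary tree\<close>

definition branch :: "(nat \<Rightarrow> bool) \<Rightarrow> nat set" where
  "branch a = (\<lambda>n. to_nat (map a [0..<n])) ` UNIV"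

text \<open>Distinct branches share only finitely many nodes, so finitely many other branches remove
  only a finite part of an infinite one.\<close>

lemma infinite_branch_diff:
  assumes "finite A" "a \<notin> A"
  shows "infinite (branch a - (\<Union>b\<in>A. branch b))"
proof -
  have inj: "inj (\<lambda>n. to_nat (map a [0..<n]))"
    by (rule injI) (metis length_map length_upt diff_zero to_nat_split inj_to_nat injD)
  have "finite (branch a \<inter> branch b)" if "a \<noteq> b" for b
  proof -
    obtain m where m: "a m \<noteq> b m" using \<open>a \<noteq> b\<close> by auto
    \<comment> \<open>A segment of length \<open>n\<close> sees the digit at \<open>m\<close> only
      when \<open>n > m\<close>, so common segments have length at most \<open>m\<close>.\<close>
    have "n \<le> m" if "map a [0..<n] = map b [0..<n']" for n n'
    proof (rule ccontr)
      assume "\<not> n \<le> m"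
      moreover have "n = n'" using arg_cong[OF that, of length] by simp
      ultimately have "map a [0..<n] ! m = a m" "map b [0..<n'] ! m = b m"
        by simp_all
      with that m show False by simp
    qed
    then have "branch a \<inter> branch b \<subseteq> (\<lambda>n. to_nat (map a [0..<n])) ` {..m}"
      unfolding branch_def by (auto dest: injD[OF inj_to_nat])
    then show ?thesis
      using finite_subset by blast
  qed
  then have "finite (\<Union>b\<in>A. branch a \<inter> branch b)"
    using assms(2) by (intro finite_UN_I[OF assms(1)]) metis
  moreover have "infinite (branch a)"
    unfolding branch_def using inj by (simp add: finite_image_iff)
  moreover have "branch a - (\<Union>b\<in>A. branch b) = branch a - (\<Union>b\<in>A. branch a \<inter> branch b)"
    by blast
  ultimately show ?thesis
    by (metis Diff_infinite_finite)
qed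

section \<open>Ideals from prime filters\<close>

text \<open>The inverse of the zero set map applied to a filter, as in the classical correspondence
  for z-ideals.\<close>

definition filter_ideal :: "real set set \<Rightarrow> (real \<Rightarrow> 'k::real_normed_field) set" where
  "filter_ideal F = {f \<in> C0. zero_set f \<in> F}"

lemma closed_zero_set: "f \<in> C0 \<Longrightarrow> closed (zero_set f)"
  unfolding C0_def zero_set_def by (auto intro!: continuous_closed_vimage simp: continuous_on_eq_continuous_at)

lemma C0_add: "f \<in> C0 \<Longrightarrow> g \<in> C0 \<Longrightarrow> (\<lambda>x. f x + g x) \<in> C0"
  unfolding C0_def using tendsto_add[of f 0 at_infinity g 0] by (auto intro: continuous_intros)

lemma C0_scale: "f \<in> C0 \<Longrightarrow> (\<lambda>x. c * f x) \<in> C0"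
  unfolding C0_def using tendsto_mult[OF tendsto_const[of c], of f 0 at_infinity]
  by (auto intro: continuous_intros)

lemma C0_mult: "f \<in> C0 \<Longrightarrow> g \<in> C0 \<Longrightarrow> (\<lambda>x. f x * g x) \<in> C0"
  unfolding C0_def using tendsto_mult[of f 0 at_infinity g 0] by (auto intro: continuous_intros)

lemma C0_with_zero_set:
  assumes "closed S"
  obtains f :: "real \<Rightarrow> 'k::real_normed_field" where "f \<in> C0" "zero_set f = S"
proof -
  \<comment> \<open>\<open>infdist\<close> to the empty set is 0 by convention, so a function
    without zeros needs its own case. Truncation at 1 and division by
    \<open>1 + \<bar>x\<bar>\<close> below give decay at infinity.\<close>
  define g where "g x = (if S = {} then 1 else min 1 (infdist x S))" for x
  define f where "f x = (of_real (g x / (1 + \<bar>x\<bar>)) :: 'k)" for x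
  have "continuous_on UNIV g"
    unfolding g_def by (cases "S = {}") (auto intro!: continuous_intros)
  moreover have "0 \<le> g x" "g x \<le> 1" "g x = 0 \<longleftrightarrow> x \<in> S" for x
    using in_closed_iff_infdist_zero[OF assms] infdist_nonneg[of x S] by (auto simp: g_def min_def)
  ultimately have g: "continuous_on UNIV g" "\<And>x. 0 \<le> g x" "\<And>x. g x \<le> 1" "\<And>x. g x = 0 \<longleftrightarrow> x \<in> S"
    by auto
  have pos: "1 + \<bar>x\<bar> > 0" "1 + \<bar>x\<bar> \<noteq> 0" for x :: real
    by linarith+
  have "norm (f x) \<le> norm (inverse x)" if "1 \<le> norm x" for x
  proof -
    have "norm (f x) = g x / (1 + \<bar>x\<bar>)"
      unfolding f_def norm_of_real using g(2)[of x] pos(1)[of x] by simp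
    also have "\<dots> \<le> 1 / \<bar>x\<bar>"
      using that g(2,3)[of x] by (intro frac_le) auto
    finally show ?thesis
      by (simp add: inverse_eq_divide)
  qed
  then have "(f \<longlongrightarrow> 0) at_infinity"
    by (intro Lim_null_comparison[OF _ tendsto_norm_zero[OF tendsto_inverse_0]])
       (auto simp: eventually_at_infinity)
  moreover have "continuous_on UNIV f"
    unfolding f_def using pos by (intro continuous_intros g) auto
  moreover have "zero_set f = S"
    unfolding zero_set_def f_def vimage_def
    using g(4) pos(2) by (simp only: singleton_iff of_real_eq_0_iff divide_eq_0_iff simp_thms Collect_mem_eq)
  ultimately show thesis
    using that unfolding C0_def by blast
qed

lemma filter_ideal_z_ideal:
  assumes "prime_closed_set_filter F"
  shows "C0_z_ideal (filter_ideal F :: (real \<Rightarrow> 'k::real_normed_field) set)"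
proof -
  note FD = prime_closed_set_filterD[OF assms]
  \<comment> \<open>The z-property also yields closure under scalar and \<open>C0\<close> multiples,
    whose zero sets can only grow.\<close>
  have z: "g \<in> filter_ideal F"
    if "g \<in> C0" "f \<in> filter_ideal F" "zero_set f \<subseteq> zero_set g" for f g :: "real \<Rightarrow> 'k"
    using that FD(4) closed_zero_set unfolding filter_ideal_def by blast
  have "(\<lambda>x. 0) \<in> (filter_ideal F :: (real \<Rightarrow> 'k) set)"
    using FD(1) by (auto simp: filter_ideal_def C0_def zero_set_def vimage_def)
  moreover have "(\<lambda>x. f x + g x) \<in> filter_ideal F"
    if "f \<in> filter_ideal F" "g \<in> filter_ideal F" for f g :: "real \<Rightarrow> 'k"
  proof -
    have fg: "f \<in> C0" "g \<in> C0" "zero_set f \<inter> zero_set g \<in> F"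
      using that FD(5) unfolding filter_ideal_def by blast+
    have "zero_set f \<inter> zero_set g \<subseteq> zero_set (\<lambda>x. f x + g x)"
      by (auto simp: zero_set_def)
    with fg show ?thesis
      using FD(4) C0_add closed_zero_set unfolding filter_ideal_def by blast
  qed
  moreover have "(\<lambda>x. c * f x) \<in> filter_ideal F" if "f \<in> filter_ideal F" for c and f :: "real \<Rightarrow> 'k"
    using that by (intro z[OF _ that]) (auto simp: filter_ideal_def C0_scale zero_set_def)
  moreover have "(\<lambda>x. g x * f x) \<in> filter_ideal F"
    if "f \<in> filter_ideal F" "g \<in> C0" for f g :: "real \<Rightarrow> 'k"
    using that by (intro z[OF _ that(1)]) (auto simp: filter_ideal_def C0_mult zero_set_def)
  ultimately show ?thesis
    using z unfolding C0_z_ideal_def C0_ideal_def by (auto simp: filter_ideal_def)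
qed

lemma filter_ideal_prime_ideal:
  assumes "prime_closed_set_filter F"
  shows "C0_prime_ideal (filter_ideal F :: (real \<Rightarrow> 'k::real_normed_field) set)"
proof -
  note FD = prime_closed_set_filterD[OF assms]
  \<comment> \<open>Properness: a function in \<open>C0\<close> may vanish nowhere on the line, and
    no filter here contains the empty set.\<close>
  obtain u :: "real \<Rightarrow> 'k" where "u \<in> C0" "zero_set u = {}"
    using C0_with_zero_set[of "{}"] by blast
  then have "u \<in> C0" "u \<notin> filter_ideal F"
    using FD(2) by (auto simp: filter_ideal_def)
  then have "filter_ideal F \<noteq> (C0 :: (real \<Rightarrow> 'k) set)"
    by blast
  moreover have "f \<in> filter_ideal F \<or> g \<in> filter_ideal F"
    if "f \<in> C0" "g \<in> C0" "(\<lambda>x. f x * g x) \<in> filter_ideal F" for f g :: "real \<Rightarrow> 'k"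
  proof -
    have "zero_set (\<lambda>x. f x * g x) = zero_set f \<union> zero_set g"
      by (auto simp: zero_set_def)
    with that show ?thesis
      using FD(6)[of "zero_set f" "zero_set g"] closed_zero_set unfolding filter_ideal_def by auto
  qed
  ultimately show ?thesis
    using filter_ideal_z_ideal[OF assms] unfolding C0_prime_ideal_def C0_z_ideal_def by blast
qed

section \<open>Closed neighbourhoods of the support point, traced on the line\<close>

definition basic_nhds :: "real option \<Rightarrow> real set set" where
  "basic_nhds p = (case p of Some a \<Rightarrow> {cball a r | r. r > 0} | None \<Rightarrow> {- ball 0 r | r. r > 0})"

text \<open>At a real point, a nonzero value would give a closed ball disjoint from the zero set,
  both in \<open>F\<close>. At infinity, a function vanishing exactly off a large ball is in the
  ideal and nonzero at the given point.\<close>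

lemma supported_at_filter_ideal:
  assumes F: "prime_closed_set_filter F" and sub: "basic_nhds p \<subseteq> F"
  shows "supported_at (filter_ideal F :: (real \<Rightarrow> 'k::real_normed_field) set) p"
proof (cases p)
  note FD = prime_closed_set_filterD[OF F]
  case (Some a)
  have "f a = 0" if f: "f \<in> filter_ideal F" for f :: "real \<Rightarrow> 'k"
  proof (rule ccontr)
    assume "f a \<noteq> 0"
    then have "a \<in> - zero_set f" "open (- zero_set f)"
      using f closed_zero_set by (auto simp: filter_ideal_def zero_set_def)
    then obtain r where "r > 0" "cball a r \<subseteq> - zero_set f"
      using open_contains_cball by blast
    moreover from this have "cball a r \<in> F"
      using sub Some by (auto simp: basic_nhds_def)
    moreover have "zero_set f \<in> F"
      using f by (simp add: filter_ideal_def)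
    ultimately show False
      using FD(2) FD(5)[of "cball a r" "zero_set f"] by (metis disjoint_eq_subset_Compl)
  qed
  with Some show ?thesis by simp
next
  case None
  have "\<exists>f\<in>filter_ideal F. f q \<noteq> (0 :: 'k)" for q
  proof -
    have N: "- ball 0 (\<bar>q\<bar> + 1) \<in> F"
      using sub None by (fastforce simp: basic_nhds_def)
    obtain f :: "real \<Rightarrow> 'k" where f: "f \<in> C0" "zero_set f = - ball 0 (\<bar>q\<bar> + 1)"
      using C0_with_zero_set[of "- ball 0 (\<bar>q\<bar> + 1)"] by blast
    have "q \<notin> zero_set f"
      using f by auto
    then have "f q \<noteq> 0"
      by (simp add: zero_set_def)
    moreover have "f \<in> filter_ideal F"
      using f N by (simp add: filter_ideal_def)
    ultimately show ?thesis by blast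
  qed
  with None show ?thesis by auto
qed

lemma basic_nhds_closed: "N \<in> basic_nhds p \<Longrightarrow> closed N"
  by (auto simp: basic_nhds_def split: option.splits)

lemma basic_nhds_nonempty: "basic_nhds p \<noteq> {}"
  using gt_ex[of "0 :: real"] by (auto simp: basic_nhds_def split: option.splits)

lemma basic_nhds_directed:
  assumes "N \<in> basic_nhds p" "N' \<in> basic_nhds p"
  shows "\<exists>M\<in>basic_nhds p. M \<subseteq> N \<inter> N'"
proof (cases p)
  case None
  then obtain r r' where r: "r > 0" "r' > 0" "N = - ball 0 r" "N' = - ball 0 r'"
    using assms by (auto simp: basic_nhds_def)
  then show ?thesis
    using None by (intro bexI[of _ "- ball 0 (max r r')"]) (auto simp: basic_nhds_def less_max_iff_disj)
next
  case (Some a)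
  then obtain r r' where r: "r > 0" "r' > 0" "N = cball a r" "N' = cball a r'"
    using assms by (auto simp: basic_nhds_def)
  then show ?thesis
    using Some by (intro bexI[of _ "cball a (min r r')"]) (auto simp: basic_nhds_def)
qed

lemma basic_nhds_interior:
  assumes "N \<in> basic_nhds p"
  shows "\<exists>M\<in>basic_nhds p. M \<subseteq> interior N"
proof (cases p)
  case None
  then obtain r where r: "r > 0" "N = - ball 0 r"
    using assms by (auto simp: basic_nhds_def)
  then show ?thesis
    using None by (intro bexI[of _ "- ball 0 (r + 1)"]) (auto simp: basic_nhds_def interior_complement)
next
  case (Some a)
  then obtain r where r: "r > 0" "N = cball a r"
    using assms by (auto simp: basic_nhds_def)
  then show ?thesis
    using Some by (intro bexI[of _ "cball a (r / 2)"]) (auto simp: basic_nhds_def)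
qed

lemma cantor_translates_meets_basic_nhds:
  assumes "N \<in> basic_nhds p"
  shows "cantor_translates (case p of None \<Rightarrow> 0 | Some a \<Rightarrow> a) M \<inter> N \<noteq> {}"
proof (cases p)
  case None
  then obtain r where r: "r > 0" "N = - ball 0 r"
    using assms by (auto simp: basic_nhds_def)
  \<comment> \<open>Integers lie in every \<open>cantor_translates 0 M\<close>, so one beyond the
    ball is a common point.\<close>
  have "real_of_int \<lceil>r\<rceil> \<in> N"
    using r by (auto simp: not_less)
  then show ?thesis
    using mem_cantor_translates[of 0 "\<lceil>r\<rceil>" M] None by auto
next
  case (Some a)
  then have "a \<in> N"
    using assms by (auto simp: basic_nhds_def)
  then show ?thesis
    using mem_cantor_translates[of a 0 M] Some by auto
qed

theorem corollary3p10:
  fixes p :: "real option"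
  assumes "p \<in> topspace (Alexandroff_compactification euclideanreal)"
  shows "\<exists>P :: (nat \<Rightarrow> bool) \<Rightarrow> (real \<Rightarrow> 'k::real_normed_field) set.
    (\<forall>\<alpha>\<in>Field continuum. C0_prime_ideal (P \<alpha>) \<and> C0_z_ideal (P \<alpha>)) \<and>
    (\<forall>f. \<forall>\<alpha>\<^sub>0\<in>Field continuum. f \<in> P \<alpha>\<^sub>0 \<longrightarrow> finite {\<alpha>\<in>Field continuum. f \<notin> P \<alpha>}) \<and>
    (\<forall>\<alpha>\<^sub>0\<in>Field continuum. \<not> (\<Inter>\<alpha>\<in>Field continuum - {\<alpha>\<^sub>0}. P \<alpha>) \<subseteq> P \<alpha>\<^sub>0) \<and>
    (\<forall>\<alpha>\<in>Field continuum. supported_at (P \<alpha>) p)"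
proof -
  \<comment> \<open>Vanishing on a union of branches means vanishing on each, so \<open>K A\<close>
    is the intersection of the \<open>K {a}\<close> for nonempty \<open>A\<close>. Indices are all
    binary sequences; restriction to \<open>Field continuum\<close> comes last.\<close>
  define K where
    "K A = cantor_translates (case p of None \<Rightarrow> 0 | Some a \<Rightarrow> a) (\<Union>a\<in>A. branch a)" for A
  have K_closed: "closed (K A)" for A
    by (simp add: K_def closed_cantor_translates)
  have K_antimono: "K B \<subseteq> K A" if "A \<subseteq> B" for A B
    unfolding K_def using that by (intro cantor_translates_antimono UN_mono) auto
  have K_dense: "K A \<subseteq> closure (K A - K {i})" if "finite A" "i \<notin> A" for A i
    using cantor_translates_dense[OF infinite_branch_diff[OF that]] by (simp add: K_def)
  have K_meets: "K A \<inter> N \<noteq> {}" if "N \<in> basic_nhds p" for A N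
    using cantor_translates_meets_basic_nhds[OF that] by (simp add: K_def)
  obtain F where F: "\<And>i. prime_closed_set_filter (F i)" "\<And>i. basic_nhds p \<subseteq> F i"
    "\<And>i Z. Z \<in> F i \<Longrightarrow> finite {j. Z \<notin> F j}"
    "\<And>i. K {i} \<notin> F i" "\<And>i j. i \<noteq> j \<Longrightarrow> K {j} \<in> F i"
    by (rule pseudofinite_prime_filters[of K "basic_nhds p", OF K_closed K_antimono K_dense K_meets basic_nhds_closed
          basic_nhds_nonempty basic_nhds_directed basic_nhds_interior])
      (assumption | rule that)+
  define P :: "(nat \<Rightarrow> bool) \<Rightarrow> (real \<Rightarrow> 'k) set" where "P i = filter_ideal (F i)" for i
  have "finite {i. f \<notin> P i}" if "f \<in> P j" for f j
    using that F(3)[of "zero_set f" j] by (simp add: P_def filter_ideal_def)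
  moreover have "\<not> (\<Inter>i\<in>S - {j}. P i) \<subseteq> P j" for S j
  proof -
    \<comment> \<open>A function with zero set exactly \<open>K {j}\<close> lies in every
      \<open>P i\<close> with \<open>i \<noteq> j\<close> but not in \<open>P j\<close>.\<close>
    obtain f :: "real \<Rightarrow> 'k" where "f \<in> C0" "zero_set f = K {j}"
      using C0_with_zero_set[OF K_closed[of "{j}"]] by blast
    then have "f \<in> (\<Inter>i\<in>S - {j}. P i)" "f \<notin> P j"
      using F(4,5) by (auto simp: P_def filter_ideal_def)
    then show ?thesis by blast
  qed
  ultimately show ?thesis
    using filter_ideal_prime_ideal[OF F(1)] filter_ideal_z_ideal[OF F(1)]
      supported_at_filter_ideal[OF F(1,2)]
    by (intro exI[of _ P]) (auto simp: P_def intro: finite_subset[rotated])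
qed

end
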